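(* Let $X$ be a Banach space and $Y,Z$ normed spaces, $U\subset X$, $V\subset Y$ open and $F\colon U\times V\to Z$ Fréchet-differentiable. Assume that $\partial_uF(0,0)\colon X\to Z$ is invertible. Furthermore, assume that there are $\rho,\tau,\kappa_1,\kappa_2,\kappa_3>0$ and a function $\omega\colon[0,\infty)^2\to[0,\infty]$, non-decreasing in both variables, such that $\overline{B_\rho(0)}\subset U$, $\overline{B_\tau(0)}\subset V$, \begin{align*} \lVert F(0,0)\rVert_Z&\le\kappa_1,\\ \lVert\partial_uF(0,0)^{-1}\rVert_{L(Z,X)}&\le\kappa_2,\\ \lVert\partial_hF(u,h)\rVert_{L(Y,Z)}&\le\kappa_3\quad\forall(u,h)\in\overline{B_\rho(0)}\times\overline{B_\tau(0)},\\ \lVert\partial_uF(0,0)-\partial_uF(u,h)\rVert_{L(X,Z)}&\le\omega(\lVert u\rVert_X,\lVert h\rVert_Y)\quad\forall(u,h)\in\overline{B_\rho(0)}\times\overline{B_\tau(0)},\\ \kappa_2\,\omega(\rho,\tau)&<1,\quad\text{and}\\ \kappa_2\Big(\kappa_1+\kappa_3\tau+\int_0^\rho\omega\big(t,\tfrac{\tau}{\rho}t\big)\,dt\Big)&\le\rho. \end{align*} Then, for every $h\in\overline{B_\tau(0)}$ there is a unique $u\in\overline{B_\rho(0)}$ with $F(u,h)=0$.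
   Context: Elements of $U\times V$ are written $(u,h)$; $\partial_uF$ and $\partial_hF$ denote the partial Fréchet derivatives with respect to the first and second variable. $\overline{B_\rho(0)}$ and $\overline{B_\tau(0)}$ are the closed balls of radius $\rho$ in $X$ and $\tau$ in $Y$, respectively. $L(\cdot,\cdot)$ denotes bounded linear operators with the operator norm. *)

theory Defs
  imports "HOL-Analysis.Analysis"
begin

definition partial_u ::
  "('x::real_normed_vector \<times> 'y::real_normed_vector \<Rightarrow> 'z::real_normed_vector) \<Rightarrow> 'x \<Rightarrow> 'y \<Rightarrow> 'x \<Rightarrow> 'z"
  where "partial_u F u h = frechet_derivative (\<lambda>v. F (v, h)) (at u)"

definition partial_h ::
  "('x::real_normed_vector \<times> 'y::real_normed_vector \<Rightarrow> 'z::real_normed_vector) \<Rightarrow> 'x \<Rightarrow> 'y \<Rightarrow> 'y \<Rightarrow> 'z"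
  where "partial_h F u h = frechet_derivative (\<lambda>k. F (u, k)) (at h)"

text \<open>
  Invertibility in \<open>L(X, Z)\<close>: the inverse is required to be bounded, which is not automatic
  because \<open>Z\<close> need not be complete.
\<close>

definition boundedly_invertible ::
  "('x::real_normed_vector \<Rightarrow> 'z::real_normed_vector) \<Rightarrow> bool"
  where "boundedly_invertible A \<longleftrightarrow> bounded_linear A \<and> bij A \<and> bounded_linear (inv A)"

end

theory Submission
  imports Defs
begin

text \<open>
  Write \<open>A = partial_u F 0 0\<close>. For fixed \<open>h\<close>, the zeros of \<open>F(\<cdot>, h)\<close> are the fixed points of the
  Newton-like map \<open>T u = u - A\<^sup>-\<^sup>1 F(u, h)\<close>, which by the mean value inequality is a contraction
  with constant \<open>\<kappa>\<^sub>2 \<omega>(\<rho>, \<tau>)\<close>. That \<open>T\<close> preserves the closed ball of radius \<open>\<rho>\<close> follows by integrating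
  the derivative of \<open>s \<mapsto> (s/\<rho>) u - A\<^sup>-\<^sup>1 F((s/\<rho>) u, (s/\<rho>) h)\<close> over \<open>[0, \<rho>]\<close>, so both arguments
  move along the ray at once. This derivative need not be continuous, but it is
  Henstock-Kurzweil integrable, so the fundamental theorem of calculus still applies.
\<close>

text \<open>The chain rule along the slice \<open>v \<mapsto> (v, h)\<close> provides a derivative,
  and uniqueness of derivatives identifies it with the value chosen by
  \<open>frechet_derivative\<close>.\<close>

lemma has_derivative_partial_u:
  assumes "(F has_derivative D) (at (u, h))"
  shows "((\<lambda>v. F (v, h)) has_derivative partial_u F u h) (at u)"
    and "partial_u F u h = (\<lambda>x. D (x, 0))"
proof -
  have "((\<lambda>v. F (v, h)) has_derivative (\<lambda>x. D (x, 0))) (at u)"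
    by (rule has_derivative_compose[of "\<lambda>v. (v, h)", OF _ assms])
       (auto intro!: derivative_eq_intros)
  then show "((\<lambda>v. F (v, h)) has_derivative partial_u F u h) (at u)"
    and "partial_u F u h = (\<lambda>x. D (x, 0))"
    unfolding partial_u_def using frechet_derivative_at by metis+
qed

lemma has_derivative_partial_h:
  assumes "(F has_derivative D) (at (u, h))"
  shows "((\<lambda>k. F (u, k)) has_derivative partial_h F u h) (at h)"
    and "partial_h F u h = (\<lambda>y. D (0, y))"
proof -
  have "((\<lambda>k. F (u, k)) has_derivative (\<lambda>y. D (0, y))) (at h)"
    by (rule has_derivative_compose[of "\<lambda>k. (u, k)", OF _ assms])
       (auto intro!: derivative_eq_intros)
  then show "((\<lambda>k. F (u, k)) has_derivative partial_h F u h) (at h)"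
    and "partial_h F u h = (\<lambda>y. D (0, y))"
    unfolding partial_h_def using frechet_derivative_at by metis+
qed

text \<open>Linearity applied to the splitting into \<open>(x, 0)\<close> and \<open>(0, y)\<close>.
  It separates the two contributions when both arguments of \<open>F\<close> move at once.\<close>

lemma has_derivative_eq_partials:
  assumes "(F has_derivative D) (at (u, h))"
  shows "D (x, y) = partial_u F u h x + partial_h F u h y"
proof -
  have "D ((x, 0) + (0, y)) = D (x, 0) + D (0, y)"
    using assms by (intro linear_add bounded_linear.linear has_derivative_bounded_linear)
  then show ?thesis
    by (simp add: has_derivative_partial_u(2)[OF assms] has_derivative_partial_h(2)[OF assms])
qed

text \<open>A mean value inequality with a bound varying along the curve. Every derivative on a
  compact interval is gauge integrable, so integrability is asked only of the majorant. It is
  applied after \<open>J\<close> has carried the values of \<open>F\<close> into the Banach space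
  X.\<close>

lemma norm_diff_le_integral:
  fixes f :: "real \<Rightarrow> 'a::banach"
  assumes "a \<le> b"
    and "\<And>t. t \<in> {a..b} \<Longrightarrow> (f has_vector_derivative f' t) (at t within {a..b})"
    and "g integrable_on {a..b}"
    and "\<And>t. t \<in> {a..b} \<Longrightarrow> norm (f' t) \<le> g t"
  shows "norm (f b - f a) \<le> integral {a..b} g"
proof -
  have "(f' has_integral (f b - f a)) {a..b}"
    using assms(1,2) by (rule fundamental_theorem_of_calculus)
  then show ?thesis
    using integral_norm_bound_integral[of f' "{a..b}" g] assms(3,4)
    by (auto simp: has_integral_iff)
qed

text \<open>Bridge from the extended-valued Lebesgue integral of the hypothesis to the real gauge
  integral used in norm estimates. By monotonicity, finiteness at \<open>b\<close> gives finiteness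
  on the whole interval, so \<open>enn2real\<close> loses nothing there.\<close>

lemma enn2real_mono_on_integral:
  fixes g :: "real \<Rightarrow> ennreal"
  assumes "mono_on {a..b} g" and "a \<le> b" and "g b < top"
  shows "(\<lambda>t. enn2real (g t)) integrable_on {a..b}"
    and "(\<integral>\<^sup>+ t\<in>{a..b}. g t \<partial>lborel) = ennreal (integral {a..b} (\<lambda>t. enn2real (g t)))"
proof -
  have fin: "g t < top" if "t \<in> {a..b}" for t
  proof -
    have "g t \<le> g b"
      using that assms(2) by (intro mono_onD[OF assms(1)]) auto
    then show ?thesis
      using assms(3) by (rule le_less_trans)
  qed
  have "mono_on {a..b} (\<lambda>t. enn2real (g t))"
    using fin assms(1) by (auto simp: mono_on_def intro!: enn2real_mono)
  then show int: "(\<lambda>t. enn2real (g t)) integrable_on {a..b}"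
    by (rule integrable_on_mono_on)
  have "(\<integral>\<^sup>+ t\<in>{a..b}. g t \<partial>lborel) = (\<integral>\<^sup>+ t\<in>{a..b}. ennreal (enn2real (g t)) \<partial>lborel)"
    using fin by (intro nn_integral_cong) (auto simp: indicator_def)
  also have "\<dots> = ennreal (integral {a..b} (\<lambda>t. enn2real (g t)))"
    using int by (intro nn_integral_has_integral_lebesgue') (auto simp: integrable_integral)
  finally show "(\<integral>\<^sup>+ t\<in>{a..b}. g t \<partial>lborel) = ennreal (integral {a..b} (\<lambda>t. enn2real (g t)))" .
qed

theorem theorem5p3:
  fixes F :: "'x::banach \<times> 'y::real_normed_vector \<Rightarrow> 'z::real_normed_vector"
    and U :: "'x set" and V :: "'y set"
    and \<rho> \<tau> \<kappa>\<^sub>1 \<kappa>\<^sub>2 \<kappa>\<^sub>3 :: real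
    and \<omega> :: "real \<Rightarrow> real \<Rightarrow> ennreal"
  assumes "open U" and "open V"
    and "F differentiable_on (U \<times> V)"
    and "\<rho> > 0" and "\<tau> > 0" and "\<kappa>\<^sub>1 > 0" and "\<kappa>\<^sub>2 > 0" and "\<kappa>\<^sub>3 > 0"
    and "\<forall>t\<ge>0. mono_on {0..} (\<lambda>s. \<omega> s t)"
    and "\<forall>s\<ge>0. mono_on {0..} (\<lambda>t. \<omega> s t)"
    and "cball 0 \<rho> \<subseteq> U" and "cball 0 \<tau> \<subseteq> V"
    and "boundedly_invertible (partial_u F 0 0)"
    and "norm (F (0, 0)) \<le> \<kappa>\<^sub>1"
    and "onorm (inv (partial_u F 0 0)) \<le> \<kappa>\<^sub>2"
    and "\<forall>u\<in>cball 0 \<rho>. \<forall>h\<in>cball 0 \<tau>. onorm (partial_h F u h) \<le> \<kappa>\<^sub>3"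
    and "\<forall>u\<in>cball 0 \<rho>. \<forall>h\<in>cball 0 \<tau>.
           ennreal (onorm (\<lambda>x. partial_u F 0 0 x - partial_u F u h x)) \<le> \<omega> (norm u) (norm h)"
    and "ennreal \<kappa>\<^sub>2 * \<omega> \<rho> \<tau> < 1"
    and "ennreal \<kappa>\<^sub>2 * (ennreal \<kappa>\<^sub>1 + ennreal (\<kappa>\<^sub>3 * \<tau>)
           + (\<integral>\<^sup>+ t\<in>{0..\<rho>}. \<omega> t (\<tau> / \<rho> * t) \<partial>lborel)) \<le> ennreal \<rho>"
  shows "\<forall>h\<in>cball 0 \<tau>. \<exists>!u. u \<in> cball 0 \<rho> \<and> F (u, h) = 0"
proof -
  define A where "A = partial_u F 0 0"
  define J where "J = inv A"
  have blA: "bounded_linear A" and bijA: "bij A" and blJ: "bounded_linear J"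
    using assms(13) by (auto simp: boundedly_invertible_def A_def J_def)
  interpret J: bounded_linear J by (rule blJ)
  have JA: "J (A x) = x" for x
    using bijA by (simp add: J_def bij_is_inj)
  \<comment> \<open>This makes the fixed points of \<open>u - J (F (u, h))\<close> exactly the zeros
    of \<open>F\<close> at the given \<open>h\<close>.\<close>
  have J0: "J z = 0 \<longleftrightarrow> z = 0" for z
    by (metis J.zero J_def bijA bij_is_surj surj_f_inv_f)
  have normJ: "norm (J z) \<le> \<kappa>\<^sub>2 * norm z" for z
    using onorm[OF blJ, of z] assms(15) mult_right_mono[of "onorm J" \<kappa>\<^sub>2 "norm z"]
    by (simp add: J_def A_def)

  have deriv: "(F has_derivative frechet_derivative F (at (u, h))) (at (u, h))"
    if "u \<in> cball 0 \<rho>" "h \<in> cball 0 \<tau>" for u h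
  proof -
    have "(u, h) \<in> U \<times> V"
      using that assms(11,12) by auto
    then have "F differentiable (at (u, h))"
      using assms(3) open_Times[OF assms(1,2)]
      by (simp add: differentiable_on_eq_differentiable_at)
    then show ?thesis
      by (simp add: frechet_derivative_works)
  qed
  have bl_u: "bounded_linear (partial_u F u h)" and bl_h: "bounded_linear (partial_h F u h)"
    if "u \<in> cball 0 \<rho>" "h \<in> cball 0 \<tau>" for u h
    using has_derivative_partial_u(1)[OF deriv[OF that]] has_derivative_partial_h(1)[OF deriv[OF that]]
    by (auto dest: has_derivative_bounded_linear)

  \<comment> \<open>\<open>enn2real\<close> sends \<open>top\<close> to 0, so \<open>W\<close>
    represents \<open>\<omega>\<close> faithfully, and is known to be monotone, only where
    \<open>\<omega>\<close> is finite. Hence the upper bounds \<open>\<rho>\<close> and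
    \<open>\<tau>\<close> in \<open>W_mono\<close>.\<close>
  define W where "W s t = enn2real (\<omega> s t)" for s t
  have \<omega>_mono: "\<omega> s t \<le> \<omega> s' t'" if "0 \<le> s" "s \<le> s'" "0 \<le> t" "t \<le> t'" for s s' t t'
  proof -
    have "\<omega> s t \<le> \<omega> s' t"
      using assms(9) that by (auto intro: mono_onD[of "{0..}" "\<lambda>s. \<omega> s t"])
    also have "\<dots> \<le> \<omega> s' t'"
      using assms(10) that by (auto intro: mono_onD[of "{0..}" "\<lambda>t. \<omega> s' t"])
    finally show ?thesis .
  qed
  \<comment> \<open>Since \<open>\<kappa>\<^sub>2\<close> is positive, an infinite
    \<open>\<omega> \<rho> \<tau>\<close> would make the product infinite, contradicting that it is
    below 1.\<close>
  have \<omega>_top: "\<omega> \<rho> \<tau> < top"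
    using assms(7,18) by (cases "\<omega> \<rho> \<tau> = top") (auto simp: ennreal_mult_top less_top)
  have \<omega>_fin: "\<omega> s t < top" if "0 \<le> s" "s \<le> \<rho>" "0 \<le> t" "t \<le> \<tau>" for s t
    using \<omega>_mono[OF that] \<omega>_top by (rule le_less_trans)
  have W_mono: "W s t \<le> W s' t'"
    if "0 \<le> s" "s \<le> s'" "s' \<le> \<rho>" "0 \<le> t" "t \<le> t'" "t' \<le> \<tau>" for s s' t t'
    unfolding W_def using that by (intro enn2real_mono \<omega>_mono \<omega>_fin) auto
  have W_nonneg: "0 \<le> W s t" for s t
    by (simp add: W_def)
  have contr: "\<kappa>\<^sub>2 * W \<rho> \<tau> < 1"
  proof -
    have "ennreal (\<kappa>\<^sub>2 * W \<rho> \<tau>) = ennreal \<kappa>\<^sub>2 * \<omega> \<rho> \<tau>"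
      using \<omega>_top assms(7) by (simp add: W_def ennreal_mult)
    then show ?thesis
      using assms(7,18) W_nonneg ennreal_less_iff[of "\<kappa>\<^sub>2 * W \<rho> \<tau>" 1] by simp
  qed
  have diff_u: "norm (A x - partial_u F u h x) \<le> W (norm u) (norm h) * norm x"
    if "u \<in> cball 0 \<rho>" "h \<in> cball 0 \<tau>" for u h x
  proof -
    have bl: "bounded_linear (\<lambda>x. A x - partial_u F u h x)"
      using blA bl_u[OF that] by (rule bounded_linear_sub)
    have "ennreal (onorm (\<lambda>x. A x - partial_u F u h x)) \<le> ennreal (W (norm u) (norm h))"
      using assms(17) that \<omega>_fin[of "norm u" "norm h"] by (simp add: W_def A_def)
    then have "onorm (\<lambda>x. A x - partial_u F u h x) \<le> W (norm u) (norm h)"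
      using W_nonneg by simp
    then show ?thesis
      using onorm[OF bl, of x] by (meson mult_right_mono norm_ge_zero order_trans)
  qed
  have diff_h: "norm (partial_h F u h y) \<le> \<kappa>\<^sub>3 * norm y"
    if "u \<in> cball 0 \<rho>" "h \<in> cball 0 \<tau>" for u h y
    using onorm[OF bl_h[OF that], of y] assms(16) that
    by (meson mult_right_mono norm_ge_zero order_trans)

  \<comment> \<open>The integrand of the hypothesis: at parameter \<open>s\<close> the ray has first
    argument of norm at most \<open>s\<close> and second of norm at most
    \<open>\<tau> / \<rho> * s\<close>.\<close>
  define g where "g s = W s (\<tau> / \<rho> * s)" for s
  have ratio: "\<tau> / \<rho> * s \<le> \<tau>" if "s \<le> \<rho>" for s
    using that assms(4,5) by (simp add: field_simps)
  have mono_ray: "mono_on {0..\<rho>} (\<lambda>s. \<omega> s (\<tau> / \<rho> * s))"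
    using assms(4,5) by (auto intro!: mono_onI \<omega>_mono mult_left_mono divide_right_mono)
  have fin_ray: "\<omega> \<rho> (\<tau> / \<rho> * \<rho>) < top"
    using \<omega>_top assms(4) by simp
  have \<rho>0: "0 \<le> \<rho>"
    using assms(4) by simp
  note ray = enn2real_mono_on_integral[OF mono_ray \<rho>0 fin_ray, folded W_def, folded g_def]
  have K_nonneg: "0 \<le> integral {0..\<rho>} g"
    using ray(1) by (rule integral_nonneg) (simp add: g_def W_nonneg)
  have small: "\<kappa>\<^sub>2 * (\<kappa>\<^sub>1 + \<kappa>\<^sub>3 * \<tau> + integral {0..\<rho>} g) \<le> \<rho>"
  proof -
    have "ennreal (\<kappa>\<^sub>2 * (\<kappa>\<^sub>1 + \<kappa>\<^sub>3 * \<tau> + integral {0..\<rho>} g)) \<le> ennreal \<rho>"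
      using assms(4-8,19) K_nonneg unfolding ray(2) by (simp add: ennreal_mult ennreal_plus)
    then show ?thesis
      using \<rho>0 by simp
  qed

  have "\<exists>!u. u \<in> cball 0 \<rho> \<and> F (u, h) = 0" if h: "h \<in> cball 0 \<tau>" for h
  proof -
    define T where "T u = u - J (F (u, h))" for u
    have lip: "dist (T u) (T v) \<le> (\<kappa>\<^sub>2 * W \<rho> \<tau>) * dist u v"
      if "u \<in> cball 0 \<rho>" "v \<in> cball 0 \<rho>" for u v
      unfolding dist_norm
    proof (rule differentiable_bound[OF convex_cball _ _ that])
      fix p assume p: "p \<in> cball (0::'x) \<rho>"
      show "(T has_derivative (\<lambda>x. x - J (partial_u F p h x))) (at p within cball 0 \<rho>)"
        unfolding T_def using has_derivative_partial_u(1)[OF deriv[OF p h]]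
        by (intro has_derivative_at_withinI[OF has_derivative_diff] has_derivative_ident J.has_derivative)
      show "onorm (\<lambda>x. x - J (partial_u F p h x)) \<le> \<kappa>\<^sub>2 * W \<rho> \<tau>"
      proof (rule onorm_bound)
        fix x
        \<comment> \<open>Writing \<open>x\<close> as \<open>J (A x)\<close> turns the derivative of
          \<open>T\<close> into \<open>J\<close> applied to the variation of the partial derivative,
          which \<open>\<omega>\<close> controls.\<close>
        have "norm (x - J (partial_u F p h x)) = norm (J (A x - partial_u F p h x))"
          by (simp add: J.diff JA)
        also have "\<dots> \<le> \<kappa>\<^sub>2 * (W (norm p) (norm h) * norm x)"
          using mult_left_mono[OF diff_u[OF p h], of \<kappa>\<^sub>2] assms(7)
          by (intro order_trans[OF normJ]) simp
        also have "\<dots> \<le> \<kappa>\<^sub>2 * (W \<rho> \<tau> * norm x)"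
          using p h assms(7) by (intro mult_left_mono mult_right_mono W_mono) auto
        finally show "norm (x - J (partial_u F p h x)) \<le> \<kappa>\<^sub>2 * W \<rho> \<tau> * norm x"
          by (simp add: mult.assoc)
      qed (use assms(7) W_nonneg in simp)
    qed
    have self: "T u \<in> cball 0 \<rho>" if u: "u \<in> cball 0 \<rho>" for u
    proof -
      \<comment> \<open>Dividing by \<open>\<rho>\<close> lets the parameter run over
        \<open>{0..\<rho>}\<close> and makes it a bound for the norm of the first argument.\<close>
      define u' where "u' = u /\<^sub>R \<rho>"
      define h' where "h' = h /\<^sub>R \<rho>"
      have u': "norm u' \<le> 1" and h': "norm h' \<le> \<tau> / \<rho>"
        using u h assms(4) by (auto simp: u'_def h'_def field_simps)
      \<comment> \<open>The curve runs from \<open>- J (F (0, 0))\<close>, of norm at most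
        \<open>\<kappa>\<^sub>2 * \<kappa>\<^sub>1\<close>, to \<open>T u\<close>.\<close>
      define G where "G s = s *\<^sub>R u' - J (F (s *\<^sub>R u', s *\<^sub>R h'))" for s
      \<comment> \<open>The derivative of \<open>G\<close>, with \<open>u'\<close> rewritten as
        \<open>J (A u')\<close>: the first term is governed by \<open>\<omega>\<close>, the second
        by \<open>\<kappa>\<^sub>3\<close>.\<close>
      define G' where
        "G' s = J (A u' - partial_u F (s *\<^sub>R u') (s *\<^sub>R h') u') - J (partial_h F (s *\<^sub>R u') (s *\<^sub>R h') h')"
        for s
      have nu: "norm (s *\<^sub>R u') \<le> s" and nh: "norm (s *\<^sub>R h') \<le> \<tau> / \<rho> * s" if "0 \<le> s" for s
        using that u' h' mult_left_mono[OF u', of s] mult_left_mono[OF h', of s]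
        by (auto simp: mult.commute)
      have mem: "s *\<^sub>R u' \<in> cball 0 \<rho>" "s *\<^sub>R h' \<in> cball 0 \<tau>" if "s \<in> {0..\<rho>}" for s
        using that nu[of s] nh[of s] ratio[of s] by auto
      have "norm (G \<rho> - G 0) \<le> integral {0..\<rho>} (\<lambda>s. \<kappa>\<^sub>2 * (g s + \<kappa>\<^sub>3 * (\<tau> / \<rho>)))"
      proof (rule norm_diff_le_integral[OF \<rho>0])
        fix s assume s: "s \<in> {0..\<rho>}"
        let ?p = "s *\<^sub>R u'" and ?q = "s *\<^sub>R h'"
        let ?D = "frechet_derivative F (at (?p, ?q))"
        note D = deriv[OF mem[OF s]]
        interpret D: bounded_linear ?D
          using D by (rule has_derivative_bounded_linear)
        have "((\<lambda>s. F (s *\<^sub>R u', s *\<^sub>R h')) has_derivative (\<lambda>r. ?D (r *\<^sub>R u', r *\<^sub>R h'))) (at s)"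
          by (rule has_derivative_compose[of "\<lambda>s. (s *\<^sub>R u', s *\<^sub>R h')", OF _ D])
             (auto intro!: derivative_eq_intros)
        then have "(G has_derivative (\<lambda>r. r *\<^sub>R u' - J (?D (r *\<^sub>R u', r *\<^sub>R h')))) (at s)"
          unfolding G_def by (auto intro!: derivative_eq_intros J.has_derivative)
        moreover have "r *\<^sub>R u' - J (?D (r *\<^sub>R u', r *\<^sub>R h')) = r *\<^sub>R G' s" for r
        proof -
          have "?D (r *\<^sub>R u', r *\<^sub>R h') = r *\<^sub>R ?D (u', h')"
            by (metis D.scaleR scaleR_Pair)
          then show ?thesis
            by (simp add: G'_def has_derivative_eq_partials[OF D] J.scaleR J.diff J.add JA
                scaleR_right_diff_distrib scaleR_right_distrib)
        qed
        ultimately show "(G has_vector_derivative G' s) (at s within {0..\<rho>})"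
          by (simp add: has_vector_derivative_def has_derivative_at_withinI)
        have "norm (A u' - partial_u F ?p ?q u') \<le> W (norm ?p) (norm ?q) * norm u'"
          using mem[OF s] by (rule diff_u)
        also have "\<dots> \<le> g s * 1"
          unfolding g_def using s nu[of s] nh[of s] ratio[of s] u' W_nonneg
          by (intro mult_mono W_mono) auto
        finally have 1: "norm (A u' - partial_u F ?p ?q u') \<le> g s" by simp
        have "norm (partial_h F ?p ?q h') \<le> \<kappa>\<^sub>3 * norm h'"
          using mem[OF s] by (rule diff_h)
        also have "\<dots> \<le> \<kappa>\<^sub>3 * (\<tau> / \<rho>)"
          using h' assms(8) by (intro mult_left_mono) auto
        finally have 2: "norm (partial_h F ?p ?q h') \<le> \<kappa>\<^sub>3 * (\<tau> / \<rho>)" .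
        have "norm (G' s) \<le> \<kappa>\<^sub>2 * norm (A u' - partial_u F ?p ?q u') + \<kappa>\<^sub>2 * norm (partial_h F ?p ?q h')"
          unfolding G'_def by (rule order_trans[OF norm_triangle_ineq4 add_mono[OF normJ normJ]])
        also have "\<dots> \<le> \<kappa>\<^sub>2 * (g s + \<kappa>\<^sub>3 * (\<tau> / \<rho>))"
          unfolding distrib_left using assms(7) 1 2 by (intro add_mono mult_left_mono) auto
        finally show "norm (G' s) \<le> \<kappa>\<^sub>2 * (g s + \<kappa>\<^sub>3 * (\<tau> / \<rho>))" .
      next
        show "(\<lambda>s. \<kappa>\<^sub>2 * (g s + \<kappa>\<^sub>3 * (\<tau> / \<rho>))) integrable_on {0..\<rho>}"
          using ray(1) by (intro integrable_on_mult_right integrable_add integrable_const_ivl)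
      qed
      \<comment> \<open>The constant \<open>\<kappa>\<^sub>3 * (\<tau> / \<rho>)\<close> integrated
        over an interval of length \<open>\<rho>\<close> gives
        \<open>\<kappa>\<^sub>3 * \<tau>\<close>.\<close>
      also have "\<dots> = \<kappa>\<^sub>2 * (integral {0..\<rho>} g + \<kappa>\<^sub>3 * \<tau>)"
        using ray(1) assms(4) by (simp add: integral_add integrable_const_ivl)
      finally have "norm (G \<rho> - G 0) \<le> \<kappa>\<^sub>2 * (integral {0..\<rho>} g + \<kappa>\<^sub>3 * \<tau>)" .
      moreover have "G \<rho> = T u"
        using assms(4) by (simp add: G_def T_def u'_def h'_def)
      moreover have "norm (G 0) \<le> \<kappa>\<^sub>2 * \<kappa>\<^sub>1"
        using order_trans[OF normJ mult_left_mono[OF assms(14)]] assms(7)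
        by (simp add: G_def zero_prod_def)
      ultimately have "norm (T u) \<le> \<kappa>\<^sub>2 * (\<kappa>\<^sub>1 + \<kappa>\<^sub>3 * \<tau> + integral {0..\<rho>} g)"
        using norm_triangle_sub[of "T u" "G 0"] by (simp add: algebra_simps)
      then show ?thesis
        using small by simp
    qed
    \<comment> \<open>The closed ball is complete because X is, and nonempty because
      \<open>\<rho>\<close> is nonnegative.\<close>
    have "\<exists>!u. u \<in> cball 0 \<rho> \<and> T u = u"
      using \<rho>0 assms(7) W_nonneg contr self lip
      by (intro Banach_fix[where c = "\<kappa>\<^sub>2 * W \<rho> \<tau>"]) (auto simp: complete_eq_closed)
    then show ?thesis
      by (simp add: T_def J0)
  qed
  then show ?thesis by blast
qed

end
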